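(* Let $R=\mathbb F_{q_1}\times\cdots\times\mathbb F_{q_t}$ be a product of $t\ge 3$ finite fields of orders $q_1,\dots,q_t$. Fix $k\in[t]$ and let $S=[t]\setminus\{k\}$. Then $$\omega(\mathcal D(R))\ \ge\ (q_k-1)\Biggl(1+\sum_{\substack{B\subseteq S\\ 1\le|B|\le t-3}}\ \prod_{i\in B}(q_i-1)\Biggr)+(t-1).$$
   Context: $[t]=\{1,\dots,t\}$. $Z(R)$ is the set of zero-divisors of $R$ and $Z(R)^*=Z(R)\setminus\{0\}$. $\Gamma(R)$ is the simple graph with vertex set $Z(R)^*$, with distinct $x,y$ adjacent iff $xy=0$. $W\Gamma(R)$ is the simple graph with vertex set $Z(R)^*$, with distinct $x,y$ adjacent iff there exist nonzero $r\in\operatorname{Ann}(x)$ and nonzero $s\in\operatorname{Ann}(y)$ with $rs=0$. The weak zero-divisor difference graph $\mathcal D(R)$ is the graph on $Z(R)^*$ with edge set $E(W\Gamma(R))\setminus E(\Gamma(R))$, with resulting isolated vertices deleted. $\omega(G)$ is the clique number of $G$. Empty sums are $0$. *)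

theory Defs
  imports "HOL-Algebra.Algebra" "HOL-Library.Ramsey"
begin

definition annihilator :: "('a, 'm) ring_scheme \<Rightarrow> 'a \<Rightarrow> 'a set"
  where "annihilator R x = {r \<in> carrier R. r \<otimes>\<^bsub>R\<^esub> x = \<zero>\<^bsub>R\<^esub>}"

text \<open>All rings considered are commutative, so left and right zero-divisors agree. In a nonzero
  ring \<open>\<zero>\<close> counts as a zero-divisor.\<close>

definition zero_divisors :: "('a, 'm) ring_scheme \<Rightarrow> 'a set"
  where "zero_divisors R =
    {x \<in> carrier R. \<exists>y \<in> carrier R. y \<noteq> \<zero>\<^bsub>R\<^esub> \<and> x \<otimes>\<^bsub>R\<^esub> y = \<zero>\<^bsub>R\<^esub>}"

definition nonzero_zero_divisors :: "('a, 'm) ring_scheme \<Rightarrow> 'a set"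
  where "nonzero_zero_divisors R = zero_divisors R - {\<zero>\<^bsub>R\<^esub>}"

text \<open>A simple graph is a pair of a vertex set and a set of two-element sets of vertices, so that
  its cliques are those of \<^const>\<open>clique\<close>.\<close>

type_synonym 'v sgraph = "'v set \<times> 'v set set"

definition zero_divisor_graph :: "('a, 'm) ring_scheme \<Rightarrow> 'a sgraph"
  where "zero_divisor_graph R =
    (nonzero_zero_divisors R,
     {{x, y} | x y. x \<in> nonzero_zero_divisors R \<and> y \<in> nonzero_zero_divisors R \<and> x \<noteq> y \<and>
        x \<otimes>\<^bsub>R\<^esub> y = \<zero>\<^bsub>R\<^esub>})"

definition weak_zero_divisor_graph :: "('a, 'm) ring_scheme \<Rightarrow> 'a sgraph"
  where "weak_zero_divisor_graph R =
    (nonzero_zero_divisors R,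
     {{x, y} | x y. x \<in> nonzero_zero_divisors R \<and> y \<in> nonzero_zero_divisors R \<and> x \<noteq> y \<and>
        (\<exists>r \<in> annihilator R x - {\<zero>\<^bsub>R\<^esub>}. \<exists>s \<in> annihilator R y - {\<zero>\<^bsub>R\<^esub>}.
           r \<otimes>\<^bsub>R\<^esub> s = \<zero>\<^bsub>R\<^esub>)})"

definition delete_isolated :: "'v sgraph \<Rightarrow> 'v sgraph"
  where "delete_isolated G = ({v \<in> fst G. \<exists>e \<in> snd G. v \<in> e}, snd G)"

definition weak_zero_divisor_difference_graph :: "('a, 'm) ring_scheme \<Rightarrow> 'a sgraph"
  where "weak_zero_divisor_difference_graph R =
    delete_isolated
      (nonzero_zero_divisors R,
       snd (weak_zero_divisor_graph R) - snd (zero_divisor_graph R))"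

text \<open>The maximum is meaningful for graphs with finitely many vertices only; the empty set is
  always a clique, so it is then taken over a finite nonempty set.\<close>

definition clique_number :: "'v sgraph \<Rightarrow> nat"
  where "clique_number G = Max {card K | K. K \<subseteq> fst G \<and> clique K (snd G)}"

end

theory Submission
  imports Defs
begin

text \<open>Two elements of the product whose supports share the index \<open>k\<close> are never adjacent in the
  zero-divisor graph, and they are adjacent in the weak zero-divisor graph as soon as their zero
  sets contain two different indices, one from each. Hence all elements with \<open>k\<close> in the support
  and at least two zero coordinates, together with one element of zero set \<open>{j}\<close> for every
  \<open>j \<noteq> k\<close>, form a clique of the difference graph.\<close>

section \<open>Coordinatewise arithmetic in list products of rings\<close>

lemma RDirProd_list_Cons_mult:
  assumes "a \<in> carrier R" "b \<in> carrier R"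
    and "as \<in> carrier (RDirProd_list Rs)" "bs \<in> carrier (RDirProd_list Rs)"
  shows "(a # as) \<otimes>\<^bsub>RDirProd_list (R # Rs)\<^esub> (b # bs) =
    (a \<otimes>\<^bsub>R\<^esub> b) # (as \<otimes>\<^bsub>RDirProd_list Rs\<^esub> bs)"
  \<comment> \<open>Prepending the head is a ring homomorphism from the binary product, where
    multiplication acts on pairs.\<close>
  using ring_hom_mult[OF RDirProd_list_hom1, of "(a, as)" R Rs "(b, bs)"] assms
  by (simp add: RDirProd_carrier) (simp add: RDirProd_def DirProd_def monoid.defs)

lemma map_in_carrier_RDirProd_list:
  assumes "\<And>i. i \<in> set xs \<Longrightarrow> f i \<in> carrier (F i)"
  shows "map f xs \<in> carrier (RDirProd_list (map F xs))"
  using assms by (intro RDirProd_list_carrier_memI) auto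

lemma RDirProd_list_map_mult:
  assumes "\<And>i. i \<in> set xs \<Longrightarrow> f i \<in> carrier (F i)"
    and "\<And>i. i \<in> set xs \<Longrightarrow> g i \<in> carrier (F i)"
  shows "map f xs \<otimes>\<^bsub>RDirProd_list (map F xs)\<^esub> map g xs = map (\<lambda>i. f i \<otimes>\<^bsub>F i\<^esub> g i) xs"
  using assms
proof (induction xs)
  case Nil
  then show ?case
    by (simp add: monoid.defs)
next
  case (Cons x xs)
  then show ?case
    by (simp add: RDirProd_list_Cons_mult map_in_carrier_RDirProd_list)
qed

lemma RDirProd_list_map_zero:
  "\<zero>\<^bsub>RDirProd_list (map F xs)\<^esub> = map (\<lambda>i. \<zero>\<^bsub>F i\<^esub>) xs"
  unfolding RDirProd_list_zero by (induction xs) simp_all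

lemma finite_carrier_RDirProd_list:
  assumes "\<And>R. R \<in> set Rs \<Longrightarrow> finite (carrier R)"
  shows "finite (carrier (RDirProd_list Rs))"
  using assms by (induction Rs) (simp_all add: RDirProd_list_carrier)

section \<open>Cliques in finite graphs and the deletion of isolated vertices\<close>

lemma card_le_clique_number:
  assumes "finite (fst G)" "K \<subseteq> fst G" "clique K (snd G)"
  shows "card K \<le> clique_number G"
proof -
  have "{card K | K. K \<subseteq> fst G \<and> clique K (snd G)} \<subseteq> card ` Pow (fst G)"
    by auto
  then have "finite {card K | K. K \<subseteq> fst G \<and> clique K (snd G)}"
    using assms(1) by (meson finite_Pow_iff finite_imageI finite_subset)
  then show ?thesis
    unfolding clique_number_def using assms(2,3) by (intro Max_ge) auto
qed

text \<open>Allows a clique to be built before the deletion. The bound on the cardinality excludes a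
  lone isolated vertex, which is also a clique; a second member provides an edge.\<close>

lemma clique_subset_delete_isolated:
  assumes "K \<subseteq> V" "clique K E" "card K \<ge> 2"
  shows "K \<subseteq> fst (delete_isolated (V, E))"
proof
  fix v assume "v \<in> K"
  have "\<not> K \<subseteq> {v}"
    using assms(3) card_mono[of "{v}" K] by auto
  then obtain w where "w \<in> K" "w \<noteq> v"
    by blast
  then have "{v, w} \<in> E"
    using assms(2) \<open>v \<in> K\<close> by (simp add: clique_def)
  then show "v \<in> fst (delete_isolated (V, E))"
    using \<open>v \<in> K\<close> assms(1) by (auto simp: delete_isolated_def)
qed

section \<open>Families over finite fields and their supports\<close>

locale finite_field_family =
  fixes F :: "'i \<Rightarrow> ('a, 'm) ring_scheme" and xs :: "'i list"
  assumes fields: "i \<in> set xs \<Longrightarrow> field (F i)"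
    and finite_fields: "i \<in> set xs \<Longrightarrow> finite (carrier (F i))"
    and distinct_indices: "distinct xs"
begin

abbreviation prod_ring :: "'a list ring"
  where "prod_ring \<equiv> RDirProd_list (map F xs)"

text \<open>Functions on the indices stand for the lists in the product; extensionality makes
  \<open>map f xs\<close> determine \<open>f\<close>.\<close>

definition families :: "('i \<Rightarrow> 'a) set"
  where "families = (\<Pi>\<^sub>E i\<in>set xs. carrier (F i))"

definition supp :: "('i \<Rightarrow> 'a) \<Rightarrow> 'i set"
  where "supp f = {i \<in> set xs. f i \<noteq> \<zero>\<^bsub>F i\<^esub>}"

text \<open>The idempotents of the product. They serve as annihilating witnesses and as the clique
  members with a single zero coordinate.\<close>

definition ind :: "'i set \<Rightarrow> 'i \<Rightarrow> 'a"
  where "ind A = (\<lambda>i\<in>set xs. if i \<in> A then \<one>\<^bsub>F i\<^esub> else \<zero>\<^bsub>F i\<^esub>)"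

lemma supp_subset: "supp f \<subseteq> set xs"
  by (auto simp: supp_def)

lemma families_closed: "f \<in> families \<Longrightarrow> i \<in> set xs \<Longrightarrow> f i \<in> carrier (F i)"
  by (auto simp: families_def)

lemma zero_closed_field: "i \<in> set xs \<Longrightarrow> \<zero>\<^bsub>F i\<^esub> \<in> carrier (F i)"
  and one_closed_field: "i \<in> set xs \<Longrightarrow> \<one>\<^bsub>F i\<^esub> \<in> carrier (F i)"
  and one_not_zero_field: "i \<in> set xs \<Longrightarrow> \<one>\<^bsub>F i\<^esub> \<noteq> \<zero>\<^bsub>F i\<^esub>"
  using fields
  by (simp_all add: field.is_ring ring.ring_simprules domain.one_not_zero field.axioms(1))

lemma ind_in_families: "ind A \<in> families"
  by (auto simp: ind_def families_def zero_closed_field one_closed_field)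

lemma supp_ind: "A \<subseteq> set xs \<Longrightarrow> supp (ind A) = A"
  by (auto simp: ind_def supp_def one_not_zero_field split: if_splits)

lemma map_in_prod_ring: "f \<in> families \<Longrightarrow> map f xs \<in> carrier prod_ring"
  by (simp add: families_closed map_in_carrier_RDirProd_list)

lemma inj_on_map_families: "inj_on (\<lambda>f. map f xs) families"
  by (auto simp: inj_on_def families_def intro: PiE_ext)

lemma map_eq_zero_iff: "map f xs = \<zero>\<^bsub>prod_ring\<^esub> \<longleftrightarrow> supp f = {}"
  by (auto simp: RDirProd_list_map_zero supp_def)

text \<open>Each factor is a domain, so a coordinate of the product vanishes only if one of the two
  entries does. This turns the ring conditions into set conditions on supports.\<close>

lemma mult_eq_zero_iff:
  assumes "f \<in> families" "g \<in> families"
  shows "map f xs \<otimes>\<^bsub>prod_ring\<^esub> map g xs = \<zero>\<^bsub>prod_ring\<^esub> \<longleftrightarrow> supp f \<inter> supp g = {}"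
proof -
  have "f i \<otimes>\<^bsub>F i\<^esub> g i = \<zero>\<^bsub>F i\<^esub> \<longleftrightarrow> f i = \<zero>\<^bsub>F i\<^esub> \<or> g i = \<zero>\<^bsub>F i\<^esub>" if "i \<in> set xs" for i
    using domain.integral_iff[OF field.axioms(1)[OF fields[OF that]]]
      families_closed[OF assms(1) that] families_closed[OF assms(2) that] by simp
  then show ?thesis
    using assms
    by (auto simp: RDirProd_list_map_mult RDirProd_list_map_zero families_closed supp_def)
qed

section \<open>Zero-divisors and edges in terms of supports\<close>

lemma map_in_nonzero_zero_divisors:
  assumes "f \<in> families" "supp f \<noteq> {}" "supp f \<noteq> set xs"
  shows "map f xs \<in> nonzero_zero_divisors prod_ring"
proof -
  \<comment> \<open>The idempotent on the zero coordinates of \<open>f\<close> annihilates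
    \<open>f\<close>, and it is nonzero because the support is proper.\<close>
  let ?g = "ind (set xs - supp f)"
  have supp_g: "supp ?g = set xs - supp f"
    by (simp add: supp_ind)
  have "map ?g xs \<noteq> \<zero>\<^bsub>prod_ring\<^esub>"
    using assms(3) supp_subset[of f] by (auto simp: map_eq_zero_iff supp_g)
  moreover have "map f xs \<otimes>\<^bsub>prod_ring\<^esub> map ?g xs = \<zero>\<^bsub>prod_ring\<^esub>"
    using assms(1) by (auto simp: mult_eq_zero_iff ind_in_families supp_g)
  moreover have "map f xs \<noteq> \<zero>\<^bsub>prod_ring\<^esub>"
    using assms(2) by (simp add: map_eq_zero_iff)
  ultimately show ?thesis
    using map_in_prod_ring[OF assms(1)] map_in_prod_ring[OF ind_in_families]
    unfolding nonzero_zero_divisors_def zero_divisors_def by blast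
qed

lemma map_ind_in_annihilator:
  assumes "f \<in> families" "i \<in> set xs - supp f"
  shows "map (ind {i}) xs \<in> annihilator prod_ring (map f xs) - {\<zero>\<^bsub>prod_ring\<^esub>}"
  using assms
  by (auto simp: annihilator_def map_in_prod_ring ind_in_families mult_eq_zero_iff
      map_eq_zero_iff supp_ind)

lemma difference_edge:
  assumes f: "f \<in> families" and g: "g \<in> families" and "f \<noteq> g"
    and meet: "supp f \<inter> supp g \<noteq> {}"
    and i: "i \<in> set xs - supp f" and j: "j \<in> set xs - supp g" and "i \<noteq> j"
  shows "{map f xs, map g xs} \<in>
    snd (weak_zero_divisor_graph prod_ring) - snd (zero_divisor_graph prod_ring)"
proof
  \<comment> \<open>The idempotents at the zero coordinates \<open>i\<close> of \<open>f\<close> and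
    \<open>j\<close> of \<open>g\<close> are the required annihilators; their product is zero since
    \<open>i\<close> and \<open>j\<close> differ.\<close>
  have "map (ind {i}) xs \<otimes>\<^bsub>prod_ring\<^esub> map (ind {j}) xs = \<zero>\<^bsub>prod_ring\<^esub>"
    using i j \<open>i \<noteq> j\<close> by (simp add: mult_eq_zero_iff ind_in_families supp_ind)
  moreover have "map f xs \<noteq> map g xs"
    using inj_on_map_families f g \<open>f \<noteq> g\<close> by (meson inj_onD)
  moreover have "map f xs \<in> nonzero_zero_divisors prod_ring"
      "map g xs \<in> nonzero_zero_divisors prod_ring"
    using f g meet i j by (auto intro!: map_in_nonzero_zero_divisors)
  ultimately show "{map f xs, map g xs} \<in> snd (weak_zero_divisor_graph prod_ring)"
    using map_ind_in_annihilator[OF f i] map_ind_in_annihilator[OF g j]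
    unfolding weak_zero_divisor_graph_def snd_conv by blast
  \<comment> \<open>An unordered pair matches an edge in two ways; either would force disjoint
    supports.\<close>
  show "{map f xs, map g xs} \<notin> snd (zero_divisor_graph prod_ring)"
    using f g meet
    by (auto simp: zero_divisor_graph_def doubleton_eq_iff mult_eq_zero_iff Int_commute)
qed

text \<open>Reduces the lower bound to a combinatorial condition: the shared index \<open>k\<close>
  rules out zero products, and \<open>zeros_K\<close> supplies annihilators with disjoint
  supports.\<close>

lemma card_le_clique_number_difference_graph:
  assumes "K \<subseteq> families" "card K \<ge> 2"
    and supp_K: "\<And>f. f \<in> K \<Longrightarrow> k \<in> supp f"
    and zeros_K: "\<And>f g. f \<in> K \<Longrightarrow> g \<in> K \<Longrightarrow> f \<noteq> g \<Longrightarrow>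
      \<exists>i\<in>set xs - supp f. \<exists>j\<in>set xs - supp g. i \<noteq> j"
  shows "card K \<le> clique_number (weak_zero_divisor_difference_graph prod_ring)"
proof -
  let ?V = "nonzero_zero_divisors prod_ring"
  let ?E = "snd (weak_zero_divisor_graph prod_ring) - snd (zero_divisor_graph prod_ring)"
  let ?M = "(\<lambda>f. map f xs) ` K"
  have card_M: "card ?M = card K"
    using inj_on_map_families assms(1) by (meson card_image inj_on_subset)
  have edge: "{map f xs, map g xs} \<in> ?E"
    if f: "f \<in> K" and g: "g \<in> K" and fg: "f \<noteq> g" for f g
  proof -
    obtain i j where ij: "i \<in> set xs - supp f" "j \<in> set xs - supp g" "i \<noteq> j"
      using zeros_K[OF f g fg] by blast
    have "supp f \<inter> supp g \<noteq> {}"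
      using supp_K[OF f] supp_K[OF g] by blast
    moreover have "f \<in> families" "g \<in> families"
      using assms(1) f g by blast+
    ultimately show ?thesis
      using difference_edge fg ij by simp
  qed
  have clique: "clique ?M ?E"
    unfolding clique_def using edge by blast
  have "?M \<subseteq> ?V"
  proof
    fix x assume "x \<in> ?M"
    then obtain f where f: "f \<in> K" "x = map f xs"
      by blast
    \<comment> \<open>\<open>zeros_K\<close> speaks of pairs only, so a second member is needed to
      obtain a zero coordinate of \<open>f\<close>.\<close>
    have "\<not> K \<subseteq> {f}"
      using assms(2) card_mono[of "{f}" K] by auto
    then obtain g where "g \<in> K" "g \<noteq> f"
      by blast
    then have "supp f \<noteq> set xs"
      using zeros_K f(1) by blast
    then show "x \<in> ?V"
      using f assms(1) supp_K map_in_nonzero_zero_divisors by blast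
  qed
  then have "?M \<subseteq> fst (weak_zero_divisor_difference_graph prod_ring)"
    using clique_subset_delete_isolated[OF _ clique] card_M assms(2)
    by (simp add: weak_zero_divisor_difference_graph_def)
  moreover have "finite (carrier prod_ring)"
    by (rule finite_carrier_RDirProd_list) (auto simp: finite_fields)
  then have "finite (fst (weak_zero_divisor_difference_graph prod_ring))"
    by (rule rev_finite_subset)
      (auto simp: weak_zero_divisor_difference_graph_def delete_isolated_def
        nonzero_zero_divisors_def zero_divisors_def)
  ultimately have "card ?M \<le> clique_number (weak_zero_divisor_difference_graph prod_ring)"
    using clique
    by (intro card_le_clique_number)
      (simp_all add: weak_zero_divisor_difference_graph_def delete_isolated_def)
  then show ?thesis
    by (simp add: card_M)
qed

section \<open>Counting families with a prescribed support\<close>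

lemma families_with_supp:
  assumes "A \<subseteq> set xs"
  shows "{f \<in> families. supp f = A} =
    (\<Pi>\<^sub>E i\<in>set xs. if i \<in> A then carrier (F i) - {\<zero>\<^bsub>F i\<^esub>} else {\<zero>\<^bsub>F i\<^esub>})"
    (is "?L = ?P")
proof
  show "?L \<subseteq> ?P"
    by (auto simp: families_def supp_def PiE_iff extensional_def)
  show "?P \<subseteq> ?L"
  proof
    fix f assume f: "f \<in> ?P"
    then have *: "f i \<in> (if i \<in> A then carrier (F i) - {\<zero>\<^bsub>F i\<^esub>} else {\<zero>\<^bsub>F i\<^esub>})" if "i \<in> set xs" for i
      using that by (auto simp: PiE_iff)
    have "f \<in> families"
      using f * zero_closed_field by (fastforce simp: families_def PiE_iff split: if_splits)
    moreover have "supp f = A"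
      using * assms by (fastforce simp: supp_def split: if_splits)
    ultimately show "f \<in> ?L"
      by simp
  qed
qed

text \<open>Each index in \<open>A\<close> allows any nonzero field element, and each index outside
  allows only zero, contributing a factor 1.\<close>

lemma card_families_with_supp:
  assumes "A \<subseteq> set xs"
  shows "int (card {f \<in> families. supp f = A}) = (\<Prod>i\<in>A. int (order (F i)) - 1)"
proof -
  have "int (card (carrier (F i) - {\<zero>\<^bsub>F i\<^esub>})) = int (order (F i)) - 1" if "i \<in> A" for i
  proof -
    have "\<zero>\<^bsub>F i\<^esub> \<in> carrier (F i)" "finite (carrier (F i))"
      using that assms zero_closed_field finite_fields by auto
    \<comment> \<open>Positivity makes the truncated natural subtraction agree with the integer
      one.\<close>
    then have "card (carrier (F i)) > 0"
      by (auto simp: card_gt_0_iff)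
    then show ?thesis
      using \<open>\<zero>\<^bsub>F i\<^esub> \<in> carrier (F i)\<close> by (simp add: order_def)
  qed
  moreover have "card {f \<in> families. supp f = A} =
      (\<Prod>i\<in>set xs. if i \<in> A then card (carrier (F i) - {\<zero>\<^bsub>F i\<^esub>}) else 1)"
    unfolding families_with_supp[OF assms] by (simp add: card_PiE if_distrib cong: if_cong)
  moreover have "\<dots> = (\<Prod>i\<in>A. card (carrier (F i) - {\<zero>\<^bsub>F i\<^esub>}))"
    using assms by (simp add: prod.inter_restrict[symmetric] Int_absorb1)
  ultimately show ?thesis
    by simp
qed

lemma finite_families: "finite families"
  by (simp add: families_def finite_PiE finite_fields)

section \<open>The clique and its size\<close>

lemma clique_number_difference_graph_ge:
  assumes k: "k \<in> set xs" and length: "length xs \<ge> 3"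
  shows "int (clique_number (weak_zero_divisor_difference_graph prod_ring)) \<ge>
    (int (order (F k)) - 1) *
      (1 + (\<Sum>B | B \<subseteq> set xs - {k} \<and> 1 \<le> card B \<and> card B \<le> length xs - 3.
        \<Prod>i\<in>B. int (order (F i)) - 1))
    + (int (length xs) - 1)"
proof -
  let ?w = "\<lambda>i. int (order (F i)) - 1"
  have card_indices: "card (set xs) = length xs"
    using distinct_indices by (rule distinct_card)
  \<comment> \<open>The admissible supports in \<open>As\<close> are the sets
    \<open>insert k B\<close>. The case of empty \<open>B\<close> is added separately and yields the
    summand 1 of the bound.\<close>
  define Bs where "Bs = {B. B \<subseteq> set xs - {k} \<and> 1 \<le> card B \<and> card B \<le> length xs - 3}"
  define As where "As = insert k ` insert {} Bs"
  define K1 where "K1 = (\<Union>A\<in>As. {f \<in> families. supp f = A})"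
  \<comment> \<open>One representative per \<open>j\<close>: elements with the same single zero
    coordinate \<open>j\<close> have annihilators supported at \<open>j\<close>, so they are not
    adjacent in the weak graph.\<close>
  define K2 where "K2 = (\<lambda>j. ind (set xs - {j})) ` (set xs - {k})"
  have finite_Bs: "finite Bs"
    unfolding Bs_def by (rule finite_subset[of _ "Pow (set xs)"]) auto
  have inj: "inj_on (insert k) (insert {} Bs)"
    unfolding Bs_def by (intro inj_onI) blast
  have As: "A \<subseteq> set xs" "k \<in> A" "card A + 2 \<le> length xs" if "A \<in> As" for A
  proof -
    have "\<exists>B \<in> insert {} Bs. A = insert k B"
      using that unfolding As_def by (simp only: image_iff)
    then obtain B where B: "B \<in> insert {} Bs" and A: "A = insert k B"
      by (rule bexE)
    have B1: "B \<subseteq> set xs - {k}"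
      using B unfolding Bs_def by blast
    have B2: "card B \<le> length xs - 3"
      using B unfolding Bs_def by auto
    have "card A = Suc (card B)"
      unfolding A using finite_subset[OF B1] by (intro card_insert_disjoint) (use B1 in auto)
    \<comment> \<open>The hypothesis \<open>length\<close> rules out truncation in
      \<open>length xs - 3\<close>; adding \<open>k\<close> to \<open>B\<close> leaves at least two
      zero coordinates.\<close>
    then show "card A + 2 \<le> length xs"
      using B2 length by linarith
    show "A \<subseteq> set xs"
      using B1 k A by blast
    show "k \<in> A"
      using A by blast
  qed
  \<comment> \<open>\<open>K1\<close> is a union of fibres of \<open>supp\<close>, which are
    pairwise disjoint.\<close>
  have "int (card K1) = (\<Sum>A\<in>As. int (card {f \<in> families. supp f = A}))"
    unfolding K1_def using finite_Bs finite_families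
    by (subst card_UN_disjoint) (auto simp: As_def)
  also have "\<dots> = (\<Sum>A\<in>As. \<Prod>i\<in>A. ?w i)"
    using As by (intro sum.cong) (simp_all add: card_families_with_supp)
  also have "\<dots> = (\<Sum>B\<in>insert {} Bs. \<Prod>i\<in>insert k B. ?w i)"
    unfolding As_def sum.reindex[OF inj] by (simp only: comp_def)
  also have "\<dots> = (\<Sum>B\<in>insert {} Bs. ?w k * (\<Prod>i\<in>B. ?w i))"
  proof (intro sum.cong refl)
    fix B assume "B \<in> insert {} Bs"
    then have "B \<subseteq> set xs - {k}"
      by (auto simp: Bs_def)
    then show "(\<Prod>i\<in>insert k B. ?w i) = ?w k * (\<Prod>i\<in>B. ?w i)"
      using finite_subset by (intro prod.insert) auto
  qed
  \<comment> \<open>The empty set is not in \<open>Bs\<close>, and its empty product is the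
    1.\<close>
  also have "\<dots> = ?w k * (1 + (\<Sum>B\<in>Bs. \<Prod>i\<in>B. ?w i))"
    using finite_Bs by (subst sum_distrib_left[symmetric], subst sum.insert) (auto simp: Bs_def)
  finally have card_K1: "int (card K1) = ?w k * (1 + (\<Sum>B\<in>Bs. \<Prod>i\<in>B. ?w i))" .

  have "inj_on (\<lambda>j. ind (set xs - {j})) (set xs - {k})"
  proof (rule inj_onI)
    fix i j assume ij: "i \<in> set xs - {k}" "j \<in> set xs - {k}"
      and "ind (set xs - {i}) = ind (set xs - {j})"
    then have "set xs - {i} = set xs - {j}"
      by (metis Diff_subset supp_ind)
    then show "i = j"
      using ij by blast
  qed
  then have card_K2: "card K2 = length xs - 1"
    using k by (simp add: K2_def card_image card_indices)
  have K1: "f \<in> families \<and> k \<in> supp f \<and> card (supp f) + 2 \<le> length xs" if "f \<in> K1" for f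
    using that As by (auto simp: K1_def)
  have K2: "f \<in> families \<and> k \<in> supp f \<and> (\<exists>j\<in>set xs. f = ind (set xs - {j}) \<and> set xs - supp f = {j})"
    if "f \<in> K2" for f
    using that k by (auto simp: K2_def ind_in_families supp_ind)
  \<comment> \<open>Having two zero coordinates is recorded as having one that avoids any prescribed
    \<open>j\<close>, the form needed for adjacency.\<close>
  have zeros_K1: "\<exists>i\<in>set xs - supp f. i \<noteq> j" if "f \<in> K1" for f j
  proof (rule ccontr)
    assume "\<not> ?thesis"
    then have "set xs \<subseteq> insert j (supp f)"
      by blast
    then have "length xs \<le> card (insert j (supp f))"
      using card_indices card_mono finite_subset[OF supp_subset]
      by (metis List.finite_set finite_insert)
    also have "\<dots> \<le> Suc (card (supp f))"
      by (simp add: card_insert_le_m1 finite_subset[OF supp_subset] card_insert_if)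
    finally show False
      using K1[OF that] by simp
  qed
  \<comment> \<open>The only zero coordinate of a member of \<open>K2\<close> cannot be avoided,
    whereas members of \<open>K1\<close> avoid any given index.\<close>
  have disjoint: "K1 \<inter> K2 = {}"
    using zeros_K1 K2 by blast
  have "finite K1" "finite K2"
    using K1 K2 finite_families by (meson finite_subset subsetI)+
  then have card_K: "card (K1 \<union> K2) = card K1 + (length xs - 1)"
    using disjoint card_K2 by (simp add: card_Un_disjoint)

  \<comment> \<open>If one of the two lies in \<open>K1\<close>, a zero coordinate of the other is
    fixed first and then avoided. Two distinct members of \<open>K2\<close> miss different
    indices.\<close>
  have "\<exists>i\<in>set xs - supp f. \<exists>j\<in>set xs - supp g. i \<noteq> j"
    if f: "f \<in> K1 \<union> K2" and g: "g \<in> K1 \<union> K2" and "f \<noteq> g" for f g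
    using f
  proof
    assume "f \<in> K1"
    moreover obtain j where "j \<in> set xs - supp g"
      using g zeros_K1 K2 by blast
    ultimately show ?thesis
      using zeros_K1 by blast
  next
    assume "f \<in> K2"
    then obtain i where i: "f = ind (set xs - {i})" "set xs - supp f = {i}"
      using K2 by blast
    show ?thesis
      using g
    proof
      assume "g \<in> K1"
      then show ?thesis
        using zeros_K1 i(2) by (metis singletonI)
    next
      assume "g \<in> K2"
      then show ?thesis
        using K2[OF \<open>g \<in> K2\<close>] i \<open>f \<noteq> g\<close> by auto
    qed
  qed
  \<comment> \<open>\<open>K2\<close> alone has \<open>length xs - 1\<close> members, which is at
    least 2.\<close>
  then have "card (K1 \<union> K2) \<le> clique_number (weak_zero_divisor_difference_graph prod_ring)"
    using K1 K2 length card_K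
    by (intro card_le_clique_number_difference_graph[where k = k]) auto
  then show ?thesis
    using card_K card_K1 length unfolding Bs_def by simp
qed

end

section \<open>Specialization to the indices from 1 to \<open>t\<close>\<close>

theorem proposition6p1:
  fixes F :: "nat \<Rightarrow> ('a, 'm) ring_scheme" and q :: "nat \<Rightarrow> nat" and t k :: nat
  assumes "t \<ge> 3"
    and "\<And>i. i \<in> {1..t} \<Longrightarrow> field (F i)"
    and "\<And>i. i \<in> {1..t} \<Longrightarrow> finite (carrier (F i))"
    and "\<And>i. i \<in> {1..t} \<Longrightarrow> order (F i) = q i"
    and "k \<in> {1..t}"
  defines "R \<equiv> RDirProd_list (map F [1..<Suc t])"
    and "S \<equiv> {1..t} - {k}"
  shows "int (clique_number (weak_zero_divisor_difference_graph R)) \<ge>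
    (int (q k) - 1) *
      (1 + (\<Sum>B | B \<subseteq> S \<and> 1 \<le> card B \<and> card B \<le> t - 3. \<Prod>i\<in>B. (int (q i) - 1)))
    + (int t - 1)"
proof -
  have indices: "set [1..<Suc t] = {1..t}" "length [1..<Suc t] = t"
    by auto
  interpret finite_field_family F "[1..<Suc t]"
    by (rule finite_field_family.intro) (simp_all only: indices assms(2,3) distinct_upt)
  have "(\<Sum>B | B \<subseteq> S \<and> 1 \<le> card B \<and> card B \<le> t - 3. \<Prod>i\<in>B. int (order (F i)) - 1) =
      (\<Sum>B | B \<subseteq> S \<and> 1 \<le> card B \<and> card B \<le> t - 3. \<Prod>i\<in>B. int (q i) - 1)"
    using assms(4) by (intro sum.cong prod.cong) (auto simp: S_def)
  then show ?thesis
    using clique_number_difference_graph_ge[of k, unfolded indices] assms(1,4,5)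
    by (simp add: R_def S_def)
qed

end
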